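(* Let $b>0$, $b\notin\mathbb{Z}$, and let $\pi\colon\mathbb{R}\to\mathbb{R}$ be a minimal piecewise linear Gomory--Johnson function for right-hand side $b$. Assume that $\pi$ is continuous at $0$ from the right. Then there exists $\delta>0$ such that for all $0<\lambda<\delta$ the function $\phi_\lambda\colon\mathbb{R}\to\mathbb{R}$ defined by $$\phi_\lambda(x)=\frac{bx-\lambda\,\pi(bx)}{b-\lambda}$$ is a maximal general Dual-Feasible Function and its restriction $\phi_\lambda|_{[0,1]}$ is a maximal classical Dual-Feasible Function. These functions (that is, $\phi_\lambda$ and $\phi_\lambda|_{[0,1]}$ for $0<\lambda<\delta$) have the following properties: (i) $\pi$ has $k$ different slopes if and only if $\phi_\lambda$ has $k$ different slopes. If $b>1$, then $\pi$ has $k$ different slopes if and only if $\phi_\lambda|_{[0,1]}$ has $k$ different slopes. (ii) The general Dual-Feasible Function $\phi_\lambda$ is extreme if $\pi$ is also continuous with only 2 slope values, where its positive slope $s$ satisfies $sb>1$ and $\lambda=\frac1s$. The classical Dual-Feasible Function $\phi_\lambda|_{[0,1]}$ is extreme if $\pi$ and $\lambda$ satisfy the previous conditions and $b>3$.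
   Context: Dual-Feasible Functions. Let $D=[0,1]$ (classical case) or $D=\mathbb{R}$ (general case). A function $\phi\colon D\to D$ is a classical (resp. general) Dual-Feasible Function (DFF) if for every finite family $(x_i)_{i\in I}$ of elements of $D$, $\sum_{i\in I}x_i\le 1$ implies $\sum_{i\in I}\phi(x_i)\le 1$. A classical (resp. general) DFF $\phi$ is maximal if it is pointwise non-dominated: there is no classical (resp. general) DFF $\psi\neq\phi$ with $\psi\ge\phi$ pointwise. A maximal DFF is extreme if it cannot be written as a convex combination of two other maximal DFFs of the same type. Gomory--Johnson functions. Consider the model $x+\sum_{r\in\mathbb{R}} r\,y(r)=b$ with $x\in\mathbb{Z}$ and $y\colon\mathbb{R}\to\mathbb{Z}_{\ge0}$ of finite support. A nonnegative function $\pi\colon\mathbb{R}\to\mathbb{R}$ is a valid Gomory--Johnson function (for right-hand side $b$) if $\sum_{r\in\mathbb{R}}\pi(r)\,y(r)\ge 1$ for every feasible solution $(x,y)$. It is minimal if there is no valid function $\pi'\ne\pi$ with $\pi'\le\pi$ pointwise. (Minimal functions are $\mathbb{Z}$-periodic.) Piecewise linear means: affine on the open intervals between consecutive breakpoints (for the $\mathbb{Z}$-periodic function $\pi$, finitely many breakpoints per period); discontinuities at breakpoints are allowed. The slopes of such a function are the slopes of its affine pieces on these open intervals; "$k$ different slopes" counts distinct slope values. *)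

theory Defs
  imports Complex_Main
begin

text \<open>
  Dual-feasible functions. The domain \<open>D\<close> is \<open>{0..1}\<close> (classical) or \<open>UNIV\<close> (general). A function
  on \<open>D\<close> is represented by a total function on the reals of which only the values on \<open>D\<close> matter, so
  equality, domination and convex combinations are always taken pointwise on \<open>D\<close>. In particular, no
  explicit restriction is needed to speak about \<open>\<phi>\<close> restricted to \<open>{0..1}\<close>.
\<close>

definition dff :: "real set \<Rightarrow> (real \<Rightarrow> real) \<Rightarrow> bool" where
  "dff D \<phi> \<longleftrightarrow>
     (\<forall>x\<in>D. \<phi> x \<in> D) \<and>
     (\<forall>(I :: nat set) (x :: nat \<Rightarrow> real).
        finite I \<and> (\<forall>i\<in>I. x i \<in> D) \<and> (\<Sum>i\<in>I. x i) \<le> 1 \<longrightarrow> (\<Sum>i\<in>I. \<phi> (x i)) \<le> 1)"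

definition maximal_dff :: "real set \<Rightarrow> (real \<Rightarrow> real) \<Rightarrow> bool" where
  "maximal_dff D \<phi> \<longleftrightarrow>
     dff D \<phi> \<and>
     \<not> (\<exists>\<psi>. dff D \<psi> \<and> (\<exists>x\<in>D. \<psi> x \<noteq> \<phi> x) \<and> (\<forall>x\<in>D. \<phi> x \<le> \<psi> x))"

definition extreme_dff :: "real set \<Rightarrow> (real \<Rightarrow> real) \<Rightarrow> bool" where
  "extreme_dff D \<phi> \<longleftrightarrow>
     maximal_dff D \<phi> \<and>
     \<not> (\<exists>\<phi>1 \<phi>2 t. maximal_dff D \<phi>1 \<and> maximal_dff D \<phi>2 \<and>
          (\<exists>x\<in>D. \<phi>1 x \<noteq> \<phi> x) \<and> (\<exists>x\<in>D. \<phi>2 x \<noteq> \<phi> x) \<and>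
          0 \<le> t \<and> t \<le> 1 \<and>
          (\<forall>x\<in>D. \<phi> x = t * \<phi>1 x + (1 - t) * \<phi>2 x))"

definition valid_gj :: "real \<Rightarrow> (real \<Rightarrow> real) \<Rightarrow> bool" where
  "valid_gj b \<pi> \<longleftrightarrow>
     (\<forall>r. 0 \<le> \<pi> r) \<and>
     (\<forall>(x :: int) (y :: real \<Rightarrow> nat).
        finite {r. y r \<noteq> 0} \<and> of_int x + (\<Sum>r | y r \<noteq> 0. r * of_nat (y r)) = b
        \<longrightarrow> 1 \<le> (\<Sum>r | y r \<noteq> 0. \<pi> r * of_nat (y r)))"

definition minimal_gj :: "real \<Rightarrow> (real \<Rightarrow> real) \<Rightarrow> bool" where
  "minimal_gj b \<pi> \<longleftrightarrow>
     valid_gj b \<pi> \<and> \<not> (\<exists>\<pi>'. valid_gj b \<pi>' \<and> \<pi>' \<noteq> \<pi> \<and> (\<forall>r. \<pi>' r \<le> \<pi> r))"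

definition affine_with_slope :: "(real \<Rightarrow> real) \<Rightarrow> real \<Rightarrow> real set \<Rightarrow> bool" where
  "affine_with_slope f c S \<longleftrightarrow> (\<exists>d. \<forall>x\<in>S. f x = c * x + d)"

text \<open>
  A breakpoint set is locally finite, and \<open>f\<close> is affine on every open interval of its domain that
  avoids it; nothing is required of the values of \<open>f\<close> at the breakpoints. On \<open>{0..1}\<close> this means
  finitely many breakpoints. A \<open>\<int>\<close>-periodic function has a locally finite breakpoint set on \<open>UNIV\<close>
  if and only if it has one with finitely many breakpoints per period.
\<close>

definition breakpoint_set :: "real set \<Rightarrow> (real \<Rightarrow> real) \<Rightarrow> real set \<Rightarrow> bool" where
  "breakpoint_set D f B \<longleftrightarrow>
     B \<subseteq> D \<and> (\<forall>u v. finite (B \<inter> {u..v})) \<and>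
     (\<forall>u v. u < v \<and> {u<..<v} \<subseteq> D - B \<longrightarrow> (\<exists>c. affine_with_slope f c {u<..<v}))"

definition piecewise_linear_on :: "real set \<Rightarrow> (real \<Rightarrow> real) \<Rightarrow> bool" where
  "piecewise_linear_on D f \<longleftrightarrow> (\<exists>B. breakpoint_set D f B)"

text \<open>
  Breakpoint sets are not unique (superfluous breakpoints are allowed), but the resulting slope
  values do not depend on the choice.
\<close>

definition slopes_on :: "real set \<Rightarrow> (real \<Rightarrow> real) \<Rightarrow> real set" where
  "slopes_on D f =
     {c. \<exists>B u v. breakpoint_set D f B \<and> u < v \<and> {u<..<v} \<subseteq> D - B \<and>
                 affine_with_slope f c {u<..<v}}"

definition has_slope_count :: "real set \<Rightarrow> (real \<Rightarrow> real) \<Rightarrow> nat \<Rightarrow> bool" where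
  "has_slope_count D f k \<longleftrightarrow>
     piecewise_linear_on D f \<and> finite (slopes_on D f) \<and> card (slopes_on D f) = k"

definition gj_to_dff :: "real \<Rightarrow> (real \<Rightarrow> real) \<Rightarrow> real \<Rightarrow> real \<Rightarrow> real" where
  "gj_to_dff b \<pi> l x = (b * x - l * \<pi> (b * x)) / (b - l)"

end

theory Submission
  imports Defs "HOL-Analysis.Analysis"
begin

text \<open>
  A minimal \<open>\<pi>\<close> is subadditive, \<open>\<int>\<close>-periodic, vanishes at \<open>0\<close> and satisfies
  \<open>\<pi> r + \<pi> (b - r) = 1\<close>. Hence \<open>\<phi>(x) = (b x - l \<pi>(b x)) / (b - l)\<close> is superadditive with
  \<open>\<phi>(x) + \<phi>(1 - x) = 1\<close>, and the second property forces maximality once \<open>\<phi>\<close> is nonnegative on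
  the positive reals. By superadditivity it suffices to check nonnegativity near \<open>0\<close>, where
  right continuity makes \<open>\<pi>\<close> linear, so small \<open>l\<close> works.

  If \<open>\<pi>\<close> is continuous with slopes \<open>s > 0 \<ge> s'\<close> and \<open>l = 1/s\<close>, then \<open>\<phi>\<close> is constant
  where \<open>\<pi>\<close> has slope \<open>s\<close>. A maximal function is superadditive and nondecreasing, so the parts of
  a convex decomposition of \<open>\<phi>\<close> are constant wherever \<open>\<phi>\<close> is, and additive wherever \<open>\<phi>\<close> is.
  Additivity gives each part a single slope on all remaining pieces, and the value \<open>1\<close> at \<open>1\<close>
  fixes that slope.
\<close>

section \<open>Dual-feasible functions and substitution in lists\<close>

text \<open>Finite families become lists, since a list allows a member to be replaced by several
  others; the index set is the set of positions.\<close>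

lemma dff_sum_list_le:
  assumes "dff D \<phi>" "set xs \<subseteq> D" "sum_list xs \<le> 1"
  shows "sum_list (map \<phi> xs) \<le> 1"
proof -
  have s: "sum_list (map f xs) = (\<Sum>i\<in>{..<length xs}. f (xs ! i))" for f :: "real \<Rightarrow> real"
    by (simp add: sum_list_sum_nth atLeast0LessThan)
  have "(\<Sum>i\<in>{..<length xs}. \<phi> (xs ! i)) \<le> 1"
    using assms(1) unfolding dff_def
    by (elim conjE allE[of _ "{..<length xs}"] allE[of _ "(!) xs"] impE)
      (use assms(2,3) s[of "\<lambda>x. x"] nth_mem in auto)
  then show ?thesis by (simp add: s)
qed

lemma dffI:
  assumes "\<And>x. x \<in> D \<Longrightarrow> \<phi> x \<in> D"
    and "\<And>xs. set xs \<subseteq> D \<Longrightarrow> sum_list xs \<le> 1 \<Longrightarrow> sum_list (map \<phi> xs) \<le> 1"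
  shows "dff D \<phi>"
  unfolding dff_def
proof (intro conjI allI impI ballI)
  fix I :: "nat set" and x :: "nat \<Rightarrow> real"
  assume h: "finite I \<and> (\<forall>i\<in>I. x i \<in> D) \<and> sum x I \<le> 1"
  let ?l = "sorted_list_of_set I"
  have s: "sum_list (map f ?l) = sum f I" for f :: "nat \<Rightarrow> real"
    using h by (simp add: sum_list_distinct_conv_sum_set)
  have "sum_list (map \<phi> (map x ?l)) \<le> 1"
    using h by (intro assms(2)) (auto simp: s)
  then show "(\<Sum>i\<in>I. \<phi> (x i)) \<le> 1" using s[of "\<phi> \<circ> x"] by (simp add: o_def)
qed (use assms in auto)

text \<open>Changing the function at \<open>z\<close> is traded for changing the family, to which
  the property of the unmodified \<open>\<phi>\<close> applies. This serves dual-feasible and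
  Gomory-Johnson functions alike.\<close>

lemma sum_list_map_replace:
  fixes \<phi> :: "real \<Rightarrow> real"
  shows "sum_list (map (\<phi>(z := sum_list (map \<phi> ys))) xs) =
    sum_list (map \<phi> (concat (map (\<lambda>w. if w = z then ys else [w]) xs)))"
  by (induction xs) auto

text \<open>In a family, every \<open>z\<close> may be replaced by \<open>ys\<close>; so raising the value at \<open>z\<close> to
  the total of \<open>\<phi>\<close> over \<open>ys\<close> keeps \<open>\<phi>\<close> dual-feasible.\<close>

lemma maximal_dff_sum_list_le:
  assumes D: "D = UNIV \<or> D = {0..1}" and max: "maximal_dff D \<phi>"
    and ys: "set ys \<subseteq> D" and z: "z \<in> D" and le: "sum_list ys \<le> z"
  shows "sum_list (map \<phi> ys) \<le> \<phi> z"
proof (rule ccontr)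
  assume gt: "\<not> ?thesis"
  let ?\<psi> = "\<phi>(z := sum_list (map \<phi> ys))"
  let ?r = "\<lambda>xs. concat (map (\<lambda>w. if w = z then ys else [w]) xs)"
  have dff: "dff D \<phi>" using max by (simp add: maximal_dff_def)
  have "dff D ?\<psi>"
  proof (rule dffI)
    fix x assume x: "x \<in> D"
    \<comment> \<open>In the classical case the raised value has to stay in \<open>{0..1}\<close>:
      \<open>ys\<close> is itself a feasible family, because \<open>z \<le> 1\<close>.\<close>
    have "sum_list (map \<phi> ys) \<in> D"
      using D
    proof
      assume "D = {0..1}"
      then have "sum_list (map \<phi> ys) \<le> 1" "\<forall>y\<in>set ys. 0 \<le> \<phi> y"
        using dff_sum_list_le[OF dff ys] z le dff ys by (auto simp: dff_def)
      then show ?thesis using \<open>D = {0..1}\<close> by (auto intro!: sum_list_nonneg)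
    qed auto
    then show "?\<psi> x \<in> D" using dff x by (auto simp: dff_def)
  next
    fix xs assume xs: "set xs \<subseteq> D" "sum_list xs \<le> 1"
    have "sum_list (?r xs) \<le> sum_list xs"
      using le by (induction xs) auto
    then have "sum_list (map \<phi> (?r xs)) \<le> 1"
      using xs ys by (intro dff_sum_list_le[OF dff]) auto
    then show "sum_list (map ?\<psi> xs) \<le> 1" by (simp add: sum_list_map_replace)
  qed
  moreover have "\<exists>x\<in>D. ?\<psi> x \<noteq> \<phi> x" using z gt by (intro bexI[of _ z]) auto
  moreover have "\<forall>x\<in>D. \<phi> x \<le> ?\<psi> x" using gt by auto
  ultimately show False using max unfolding maximal_dff_def by blast
qed

section \<open>Gomory-Johnson functions: consequences of minimality\<close>

lemma sum_list_map_eq_sum_count_real: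
  fixes f :: "real \<Rightarrow> real"
  shows "sum_list (map f xs) = (\<Sum>r\<in>set xs. f r * of_nat (count_list xs r))"
proof (induction xs)
  case (Cons a xs)
  have "(\<Sum>r\<in>set (a # xs). f r * of_nat (count_list (a # xs) r)) =
        (\<Sum>r\<in>set (a # xs). f r * of_nat (count_list xs r) + (if r = a then f r else 0))"
    by (rule sum.cong) (auto simp: algebra_simps)
  also have "\<dots> = (\<Sum>r\<in>set (a # xs). f r * of_nat (count_list xs r)) + f a"
    by (subst sum.distrib) (simp add: sum.delta)
  also have "(\<Sum>r\<in>set (a # xs). f r * of_nat (count_list xs r)) =
             (\<Sum>r\<in>set xs. f r * of_nat (count_list xs r))"
    by (rule sum.mono_neutral_right) (auto simp: count_list_0_iff)
  finally show ?case using Cons by simp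
qed simp

text \<open>A list records the solution \<open>y\<close> by its multiplicities, and the integer
  variable \<open>x\<close> survives only as membership in \<open>\<int>\<close>.\<close>

lemma valid_gj_iff:
  "valid_gj b \<pi> \<longleftrightarrow> (\<forall>r. 0 \<le> \<pi> r) \<and>
     (\<forall>xs. b - sum_list xs \<in> \<int> \<longrightarrow> 1 \<le> sum_list (map \<pi> xs))"
proof (intro iffI conjI allI impI)
  fix xs :: "real list"
  assume v: "valid_gj b \<pi>" and "b - sum_list xs \<in> \<int>"
  then obtain n :: int where "b - sum_list xs = of_int n" by (auto elim: Ints_cases)
  moreover have supp: "{r. count_list xs r \<noteq> 0} = set xs" by (auto simp: count_list_0_iff)
  moreover have fin: "finite {r. count_list xs r \<noteq> 0}" unfolding supp by simp
  ultimately have "of_int n + (\<Sum>r | count_list xs r \<noteq> 0. r * of_nat (count_list xs r)) = b"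
    using sum_list_map_eq_sum_count_real[of "\<lambda>x. x" xs] by simp
  then have "1 \<le> (\<Sum>r | count_list xs r \<noteq> 0. \<pi> r * of_nat (count_list xs r))"
    using v fin unfolding valid_gj_def
    by (elim conjE allE[of _ n] allE[of _ "count_list xs"]) simp
  then show "1 \<le> sum_list (map \<pi> xs)"
    using supp by (simp add: sum_list_map_eq_sum_count_real)
next
  assume h: "(\<forall>r. 0 \<le> \<pi> r) \<and> (\<forall>xs. b - sum_list xs \<in> \<int> \<longrightarrow> 1 \<le> sum_list (map \<pi> xs))"
  show "valid_gj b \<pi>" unfolding valid_gj_def
  proof (intro conjI allI impI)
    fix n :: int and y :: "real \<Rightarrow> nat"
    assume y: "finite {r. y r \<noteq> 0} \<and> of_int n + (\<Sum>r | y r \<noteq> 0. r * of_nat (y r)) = b"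
    let ?S = "sorted_list_of_set {r. y r \<noteq> 0}"
    let ?xs = "concat (map (\<lambda>r. replicate (y r) r) ?S)"
    have "sum_list (map f (concat (map (\<lambda>r. replicate (y r) r) S))) =
          sum_list (map (\<lambda>r. f r * of_nat (y r)) S)" for f :: "real \<Rightarrow> real" and S
      by (induction S) (auto simp: sum_list_replicate)
    then have s: "sum_list (map f ?xs) = (\<Sum>r | y r \<noteq> 0. f r * of_nat (y r))"
      for f :: "real \<Rightarrow> real"
      using y by (simp add: sum_list_distinct_conv_sum_set)
    have "b - sum_list ?xs = of_int n" using y s[of "\<lambda>x. x"] by simp
    then have "b - sum_list ?xs \<in> \<int>" by simp
    then have "1 \<le> sum_list (map \<pi> ?xs)" using h by blast
    then show "1 \<le> (\<Sum>r | y r \<noteq> 0. \<pi> r * of_nat (y r))"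
      by (simp only: s)
  qed (use h in auto)
qed (auto simp: valid_gj_def)

text \<open>Otherwise the value at \<open>z\<close> could be lowered to the total over
  \<open>ys\<close>: exchanging \<open>z\<close> for \<open>ys\<close> changes the sum of a list by
  an integer, so validity persists. Lists of length zero, one and two will yield the zero at
  \<open>0\<close>, periodicity and subadditivity.\<close>

lemma minimal_gj_le_sum_list:
  assumes min: "minimal_gj b \<pi>" and ys: "sum_list ys - z \<in> \<int>"
  shows "\<pi> z \<le> sum_list (map \<pi> ys)"
proof (rule ccontr)
  assume gt: "\<not> ?thesis"
  let ?\<psi> = "\<pi>(z := sum_list (map \<pi> ys))"
  let ?r = "\<lambda>xs. concat (map (\<lambda>w. if w = z then ys else [w]) xs)"
  have val: "valid_gj b \<pi>" using min by (simp add: minimal_gj_def)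
  have int: "sum_list (?r xs) - sum_list xs \<in> \<int>" for xs
  proof (induction xs)
    case (Cons a xs)
    have eq: "sum_list (?r (a # xs)) - sum_list (a # xs) =
      (if a = z then sum_list ys - z else 0) + (sum_list (?r xs) - sum_list xs)" by simp
    show ?case unfolding eq using Cons ys by (intro Ints_add) auto
  qed simp
  have "valid_gj b ?\<psi>" unfolding valid_gj_iff
  proof (intro conjI allI impI)
    fix r show "0 \<le> ?\<psi> r"
      using val by (auto simp: valid_gj_iff intro!: sum_list_nonneg)
  next
    fix xs assume "b - sum_list xs \<in> \<int>"
    from Ints_diff[OF this int[of xs]] have "b - sum_list (?r xs) \<in> \<int>" by simp
    then show "1 \<le> sum_list (map ?\<psi> xs)"
      using val unfolding sum_list_map_replace valid_gj_iff by blast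
  qed
  moreover have "?\<psi> \<noteq> \<pi>" using gt by (metis fun_upd_same order_refl)
  moreover have "\<forall>r. ?\<psi> r \<le> \<pi> r" using gt by auto
  ultimately show False using min unfolding minimal_gj_def by blast
qed

lemma sum_list_map_fun_upd:
  fixes f :: "real \<Rightarrow> real"
  shows "sum_list (map (f(r := v)) xs) = sum_list (map f xs) - of_nat (count_list xs r) * (f r - v)"
  by (induction xs) (auto simp: algebra_simps)

lemma count_list_mult_le_sum_list:
  fixes f :: "real \<Rightarrow> real"
  assumes "\<And>x. 0 \<le> f x"
  shows "of_nat (count_list xs r) * f r \<le> sum_list (map f xs)"
proof (induction xs)
  case (Cons a xs)
  then show ?case using assms[of a] by (auto simp: algebra_simps)
qed simp

text \<open>If the sum exceeded \<open>1\<close>, scaling the value at \<open>r\<close> alone by the inverse of the sum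
  would keep the function valid.\<close>

lemma minimal_gj_symmetric_aux:
  assumes min: "minimal_gj b \<pi>" and pos: "0 < \<pi> r"
  shows "\<pi> r + \<pi> (b - r) \<le> 1"
proof (rule ccontr)
  assume gt: "\<not> ?thesis"
  define M where "M = \<pi> r + \<pi> (b - r)"
  have M: "1 < M" using gt by (simp add: M_def)
  let ?\<psi> = "\<pi>(r := \<pi> r / M)"
  have val: "valid_gj b \<pi>" using min by (simp add: minimal_gj_def)
  then have nn: "0 \<le> \<pi> x" for x by (simp add: valid_gj_def)
  then have nn': "0 \<le> ?\<psi> x" for x using M by auto
  have "1 \<le> sum_list (map ?\<psi> xs)" if xs: "b - sum_list xs \<in> \<int>" for xs
  proof (cases "r \<in> set xs")
    case False
    then have "map ?\<psi> xs = map \<pi> xs" by auto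
    then show ?thesis using val xs by (simp only: valid_gj_iff)
  next
    case True
    define n where "n = real (count_list xs r)"
    show ?thesis
    proof (cases "n * \<pi> r \<ge> M")
      \<comment> \<open>The copies of \<open>r\<close> alone cost at least \<open>M\<close> before
        scaling, hence at least \<open>1\<close> afterwards.\<close>
      case True
      then have "1 \<le> n * ?\<psi> r" using M by (simp add: field_simps)
      also have "\<dots> \<le> sum_list (map ?\<psi> xs)"
        unfolding n_def by (rule count_list_mult_le_sum_list[OF nn'])
      finally show ?thesis .
    next
      \<comment> \<open>Removing one \<open>r\<close> leaves a list that sums to
        \<open>b - r\<close> modulo \<open>\<int>\<close>, so the old cost is at least
        \<open>M\<close>; scaling loses at most \<open>M - 1\<close>.\<close>
      case False
      have split: "sum_list (map f xs) = f r + sum_list (map f (remove1 r xs))" for f :: "real \<Rightarrow> real"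
        using True by (rule sum_list_map_remove1)
      have "sum_list (remove1 r xs) - (b - r) = - (b - sum_list xs)"
        using split[of "\<lambda>x. x"] by simp
      then have "sum_list (remove1 r xs) - (b - r) \<in> \<int>" using xs by (metis Ints_minus)
      then have "\<pi> (b - r) \<le> sum_list (map \<pi> (remove1 r xs))"
        by (rule minimal_gj_le_sum_list[OF min])
      then have ge: "M \<le> sum_list (map \<pi> xs)" using split[of \<pi>] by (simp add: M_def)
      have "sum_list (map ?\<psi> xs) = sum_list (map \<pi> xs) - (n * \<pi> r) * (1 - 1 / M)"
        by (simp add: sum_list_map_fun_upd n_def algebra_simps)
      moreover have "(n * \<pi> r) * (1 - 1 / M) \<le> M * (1 - 1 / M)"
        using False M by (intro mult_right_mono) auto
      moreover have "M * (1 - 1 / M) = M - 1" using M by (simp add: field_simps)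
      ultimately show ?thesis using ge by linarith
    qed
  qed
  then have "valid_gj b ?\<psi>" using nn' by (auto simp only: valid_gj_iff)
  moreover have lt: "\<pi> r / M < \<pi> r" using M pos by (simp add: field_simps)
  then have "?\<psi> \<noteq> \<pi>" by (metis fun_upd_same less_irrefl)
  moreover have "\<forall>x. ?\<psi> x \<le> \<pi> x" using lt by auto
  ultimately show False using min unfolding minimal_gj_def by blast
qed

text \<open>The conditions in Gomory and Johnson's characterization of minimal functions; the later
  arguments rest on them instead of on minimality itself.\<close>

locale subadditive_periodic_symmetric =
  fixes b :: real and \<pi> :: "real \<Rightarrow> real"
  assumes nonneg: "0 \<le> \<pi> x"
    and zero [simp]: "\<pi> 0 = 0"
    and periodic: "n \<in> \<int> \<Longrightarrow> \<pi> (x + n) = \<pi> x"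
    and subadd: "\<pi> (x + y) \<le> \<pi> x + \<pi> y"
    and symmetric: "\<pi> x + \<pi> (b - x) = 1"

lemma minimal_gj_imp:
  assumes min: "minimal_gj b \<pi>"
  shows "subadditive_periodic_symmetric b \<pi>"
proof
  have val: "valid_gj b \<pi>" using min by (simp add: minimal_gj_def)
  then show nn: "0 \<le> \<pi> x" for x by (simp add: valid_gj_def)
  show "\<pi> 0 = 0"
    using minimal_gj_le_sum_list[OF min, of "[]" 0] nn[of 0] by simp
  show "\<pi> (x + n) = \<pi> x" if "n \<in> \<int>" for x n
    using minimal_gj_le_sum_list[OF min, of "[x]" "x + n"]
      minimal_gj_le_sum_list[OF min, of "[x + n]" "x"] that by simp
  show "\<pi> (x + y) \<le> \<pi> x + \<pi> y" for x y
    using minimal_gj_le_sum_list[OF min, of "[x, y]" "x + y"] by simp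
  show "\<pi> x + \<pi> (b - x) = 1" for x
  proof -
    have "b - sum_list [x, b - x] \<in> \<int>" by simp
    then have "1 \<le> sum_list (map \<pi> [x, b - x])" using val unfolding valid_gj_iff by blast
    then have ge: "1 \<le> \<pi> x + \<pi> (b - x)" by simp
    \<comment> \<open>The scaling argument starts from a positive value; one of two nonnegative
      numbers with sum at least \<open>1\<close> is positive, and the two roles are
      interchangeable.\<close>
    then consider "0 < \<pi> x" | "0 < \<pi> (b - x)" using nn[of x] nn[of "b - x"] by linarith
    then have "\<pi> x + \<pi> (b - x) \<le> 1"
    proof cases
      case 2
      then show ?thesis using minimal_gj_symmetric_aux[OF min, of "b - x"] by simp
    qed (rule minimal_gj_symmetric_aux[OF min])
    then show ?thesis using ge by simp
  qed
qed

section \<open>Breakpoints, affine pieces and slopes\<close>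

lemma locally_finite_right_gap:
  fixes x :: real
  assumes "\<And>u v. finite (B \<inter> {u..v})" and "x < w"
  obtains v where "x < v" "v \<le> w" "{x<..<v} \<inter> B = {}"
proof -
  \<comment> \<open>Adding \<open>w\<close> keeps the set nonempty, so the minimum exists even
    without breakpoints up to \<open>w\<close>.\<close>
  let ?S = "insert w (B \<inter> {x..w} - {x})"
  have fin: "finite ?S" using assms(1)[of x w] by simp
  have m: "Min ?S \<in> ?S" using fin by (intro Min_in) auto
  have le: "Min ?S \<le> y" if "y \<in> ?S" for y using fin that by (intro Min_le)
  have w: "Min ?S \<le> w" by (rule le) simp
  have "{x<..<Min ?S} \<inter> B = {}"
  proof (intro equals0I, elim IntE)
    fix y assume y: "y \<in> {x<..<Min ?S}" "y \<in> B"
    then have "y \<in> ?S" using w by auto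
    then show False using le[of y] y by simp
  qed
  moreover have "x < Min ?S" using m assms(2) by auto
  ultimately show ?thesis using that w by blast
qed

lemma affine_with_slope_subset:
  "affine_with_slope f c T \<Longrightarrow> S \<subseteq> T \<Longrightarrow> affine_with_slope f c S"
  by (auto simp: affine_with_slope_def)

lemma slopes_on_eq:
  assumes "piecewise_linear_on D f"
  shows "slopes_on D f =
    {c. \<exists>u v. u < v \<and> {u<..<v} \<subseteq> D \<and> affine_with_slope f c {u<..<v}}"
proof (intro set_eqI iffI)
  fix c assume "c \<in> {c. \<exists>u v. u < v \<and> {u<..<v} \<subseteq> D \<and> affine_with_slope f c {u<..<v}}"
  then obtain u v where uv: "u < v" "{u<..<v} \<subseteq> D" "affine_with_slope f c {u<..<v}" by auto
  obtain B where B: "breakpoint_set D f B" using assms by (auto simp: piecewise_linear_on_def)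
  then have "\<And>u v. finite (B \<inter> {u..v})" by (simp add: breakpoint_set_def)
  from locally_finite_right_gap[OF this uv(1)] obtain w
    where w: "u < w" "w \<le> v" "{u<..<w} \<inter> B = {}" .
  have "{u<..<w} \<subseteq> D - B" "{u<..<w} \<subseteq> {u<..<v}" using w uv by auto
  then show "c \<in> slopes_on D f"
    unfolding slopes_on_def using B w affine_with_slope_subset[OF uv(3)] by blast
qed (auto simp: slopes_on_def)

text \<open>The piece up to the next breakpoint is affine on an open interval; right continuity
  matches its limit at \<open>x\<close> with \<open>f x\<close>, so the formula extends to
  \<open>x\<close> itself.\<close>

lemma right_affine_piece:
  assumes "piecewise_linear_on UNIV f" and cont: "continuous (at_right x) f"
  shows "\<exists>r>0. \<exists>c\<in>slopes_on UNIV f. \<forall>y. x \<le> y \<and> y < x + r \<longrightarrow> f y = f x + c * (y - x)"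
proof -
  obtain B where B: "breakpoint_set UNIV f B"
    using assms by (auto simp: piecewise_linear_on_def)
  then have "\<And>u v. finite (B \<inter> {u..v})" by (simp add: breakpoint_set_def)
  from locally_finite_right_gap[OF this, of x "x + 1"] obtain v
    where v: "x < v" "{x<..<v} \<inter> B = {}" by auto
  then have "{x<..<v} \<subseteq> UNIV - B" by auto
  then obtain c where "affine_with_slope f c {x<..<v}"
    using B v(1) unfolding breakpoint_set_def by blast
  moreover from this have c: "c \<in> slopes_on UNIV f"
    using v(1) unfolding slopes_on_eq[OF assms(1)] by blast
  ultimately obtain d where d: "f y = c * y + d" if "x < y" "y < v" for y
    by (auto simp: affine_with_slope_def)
  have "eventually (\<lambda>y. y \<in> {x<..<v}) (at_right x)"
    using v(1) by (rule eventually_at_right_real)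
  then have "eventually (\<lambda>y. f y = c * y + d) (at_right x)"
    by eventually_elim (auto intro: d)
  moreover have "(f \<longlongrightarrow> f x) (at_right x)" using cont by (simp add: continuous_within)
  ultimately have "((\<lambda>y. c * y + d) \<longlongrightarrow> f x) (at_right x)"
    by (rule Lim_transform_eventually[rotated])
  moreover have "((\<lambda>y. c * y + d) \<longlongrightarrow> c * x + d) (at_right x)"
    by (intro tendsto_intros)
  ultimately have fx: "f x = c * x + d"
    by (rule tendsto_unique[OF trivial_limit_at_right_real])
  have "f y = f x + c * (y - x)" if "x \<le> y" "y < x + (v - x)" for y
    using d[of y] fx that by (cases "y = x") (auto simp: algebra_simps)
  moreover have "0 < v - x" using v(1) by simp
  ultimately show ?thesis using c by blast
qed

text \<open>After the substitution \<open>b * x\<close>, adding a linear term and scaling by a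
  nonzero factor are reversible, so affinity transfers both ways.\<close>

lemma affine_gj_to_dff_iff:
  assumes "0 < l" "l < b"
  shows "affine_with_slope (gj_to_dff b \<pi> l) (b * (1 - l * c) / (b - l)) S \<longleftrightarrow>
    affine_with_slope \<pi> c ((*) b ` S)"
proof -
  have pt: "gj_to_dff b \<pi> l x = b * (1 - l * c) / (b - l) * x + d \<longleftrightarrow>
      \<pi> (b * x) = c * (b * x) + - (b - l) * d / l" for x d
  proof -
    have eq: "l * (c * (b * x) + - (b - l) * d / l) = l * (c * (b * x)) - (b - l) * d"
      using assms by (simp add: distrib_left) (simp add: algebra_simps)
    have "gj_to_dff b \<pi> l x = b * (1 - l * c) / (b - l) * x + d \<longleftrightarrow>
        b * x - l * \<pi> (b * x) = b * (1 - l * c) * x + (b - l) * d"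
      using assms by (simp add: gj_to_dff_def field_simps)
    also have "\<dots> \<longleftrightarrow> l * \<pi> (b * x) = l * (c * (b * x) + - (b - l) * d / l)"
      unfolding eq by (simp add: algebra_simps) linarith
    finally show ?thesis using assms by simp
  qed
  show ?thesis unfolding affine_with_slope_def
  proof
    assume "\<exists>d. \<forall>x\<in>S. gj_to_dff b \<pi> l x = b * (1 - l * c) / (b - l) * x + d"
    then show "\<exists>d. \<forall>x\<in>(*) b ` S. \<pi> x = c * x + d" unfolding pt by blast
  next
    assume "\<exists>d. \<forall>x\<in>(*) b ` S. \<pi> x = c * x + d"
    then obtain d where d: "\<forall>x\<in>S. \<pi> (b * x) = c * (b * x) + d" by auto
    have "d = - (b - l) * (- l * d / (b - l)) / l" using assms by (simp add: field_simps)
    then show "\<exists>d. \<forall>x\<in>S. gj_to_dff b \<pi> l x = b * (1 - l * c) / (b - l) * x + d"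
      unfolding pt using d by (intro exI[of _ "- l * d / (b - l)"]) simp
  qed
qed

lemma image_mult_greaterThanLessThan:
  fixes b :: real
  assumes "0 < b"
  shows "(*) b ` {u<..<v} = {b * u<..<b * v}"
proof (intro set_eqI iffI)
  fix y assume "y \<in> {b * u<..<b * v}"
  then have "y / b \<in> {u<..<v}" using assms by (simp add: field_simps)
  then show "y \<in> (*) b ` {u<..<v}" using assms by (intro image_eqI[of _ _ "y / b"]) auto
qed (use assms in auto)

lemma gj_slope_inverse:
  assumes "0 < l" "l < (b::real)"
  shows "c = b * (1 - l * ((1 - (b - l) * c / b) / l)) / (b - l)"
  using assms by (simp add: field_simps)

lemma piecewise_linear_gj_to_dff:
  assumes "piecewise_linear_on UNIV \<pi>" "0 < l" "l < b"
  shows "piecewise_linear_on D (gj_to_dff b \<pi> l)"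
proof -
  have b: "0 < b" using assms by simp
  obtain B where B: "breakpoint_set UNIV \<pi> B"
    using assms by (auto simp: piecewise_linear_on_def)
  let ?B = "{x \<in> D. b * x \<in> B}"
  have "breakpoint_set D (gj_to_dff b \<pi> l) ?B"
    unfolding breakpoint_set_def
  proof (intro conjI allI impI)
    fix u v
    have "?B \<inter> {u..v} \<subseteq> (\<lambda>x. x / b) ` (B \<inter> {b * u..b * v})"
    proof
      fix x assume "x \<in> ?B \<inter> {u..v}"
      then show "x \<in> (\<lambda>x. x / b) ` (B \<inter> {b * u..b * v})"
        using b by (intro image_eqI[of _ _ "b * x"]) auto
    qed
    then show "finite (?B \<inter> {u..v})"
      using B by (auto simp: breakpoint_set_def intro: finite_subset)
  next
    fix u v assume uv: "u < v \<and> {u<..<v} \<subseteq> D - ?B"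
    then have "(*) b ` {u<..<v} \<inter> B = {}" by auto
    then have "{b * u<..<b * v} \<inter> B = {}"
      unfolding image_mult_greaterThanLessThan[OF b] .
    then have "{b * u<..<b * v} \<subseteq> UNIV - B" by auto
    moreover have "b * u < b * v" using uv b by simp
    ultimately obtain c where "affine_with_slope \<pi> c {b * u<..<b * v}"
      using B unfolding breakpoint_set_def by blast
    then show "\<exists>c. affine_with_slope (gj_to_dff b \<pi> l) c {u<..<v}"
      using affine_gj_to_dff_iff[OF assms(2,3)] image_mult_greaterThanLessThan[OF b] by metis
  qed auto
  then show ?thesis by (auto simp: piecewise_linear_on_def)
qed

context subadditive_periodic_symmetric
begin

text \<open>By periodicity every slope occurs within one period. This matters for the classical
  domain, where only arguments of \<open>\<pi>\<close> in \<open>{0..b}\<close> are seen.\<close>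

lemma slope_interval_shift:
  assumes "affine_with_slope \<pi> c {u<..<v}" "u < v"
  obtains u' v' where "u' < v'" "{u'<..<v'} \<subseteq> {0..1}" "affine_with_slope \<pi> c {u'<..<v'}"
proof -
  define n :: real where "n = of_int \<lfloor>u\<rfloor>"
  have n: "n \<le> u" "u < n + 1" "n \<in> \<int>" unfolding n_def by linarith+ auto
  \<comment> \<open>Cutting at the next integer lets the translate by \<open>- n\<close> fit into
    \<open>{0..1}\<close>.\<close>
  define w where "w = min v (n + 1)"
  have w: "u < w" "w \<le> v" "w \<le> n + 1" using n assms by (auto simp: w_def)
  obtain d where d: "\<forall>x\<in>{u<..<v}. \<pi> x = c * x + d"
    using assms by (auto simp: affine_with_slope_def)
  have "\<pi> x = c * x + (c * n + d)" if "x \<in> {u - n<..<w - n}" for x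
  proof -
    have "\<pi> (x + n) = c * (x + n) + d" using d that w by auto
    then show ?thesis using periodic[OF n(3), of x] by (simp add: algebra_simps)
  qed
  then have "affine_with_slope \<pi> c {u - n<..<w - n}" by (auto simp: affine_with_slope_def)
  moreover have "u - n < w - n" "{u - n<..<w - n} \<subseteq> {0..1}" using n w by auto
  ultimately show ?thesis using that by blast
qed

text \<open>In the classical case the delicate point is that no slope of \<open>\<pi>\<close> gets
  lost: an interval in \<open>{0..1}\<close> divided by \<open>b\<close> stays in
  \<open>{0..1}\<close> because \<open>1 \<le> b\<close>.\<close>

lemma slopes_on_gj_to_dff:
  assumes D: "D = UNIV \<or> D = {0..1} \<and> 1 \<le> b"
    and pl: "piecewise_linear_on UNIV \<pi>" and l: "0 < l" "l < b"
  shows "slopes_on D (gj_to_dff b \<pi> l) = (\<lambda>c. b * (1 - l * c) / (b - l)) ` slopes_on UNIV \<pi>"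
    (is "_ = ?h ` _")
proof -
  have b: "0 < b" using l by simp
  note eq = slopes_on_eq[OF piecewise_linear_gj_to_dff[OF pl l]] slopes_on_eq[OF pl]
  note aff = affine_gj_to_dff_iff[OF l, where \<pi> = \<pi>]
  show ?thesis
  proof (intro set_eqI iffI)
    fix c assume "c \<in> slopes_on D (gj_to_dff b \<pi> l)"
    then obtain u v where uv: "u < v" "affine_with_slope (gj_to_dff b \<pi> l) c {u<..<v}"
      unfolding eq by auto
    define c' where "c' = (1 - (b - l) * c / b) / l"
    have c: "c = ?h c'" unfolding c'_def by (rule gj_slope_inverse[OF l])
    have "affine_with_slope \<pi> c' {b * u<..<b * v}"
      using uv(2) unfolding c aff image_mult_greaterThanLessThan[OF b] .
    moreover have "b * u < b * v" using uv b by simp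
    ultimately have "c' \<in> slopes_on UNIV \<pi>" unfolding eq by blast
    then show "c \<in> ?h ` slopes_on UNIV \<pi>" using c by blast
  next
    fix c assume "c \<in> ?h ` slopes_on UNIV \<pi>"
    then obtain c' u v where c: "c = ?h c'" "u < v" "affine_with_slope \<pi> c' {u<..<v}"
      unfolding eq by auto
    obtain u' v' where uv: "u' < v'" "{u'<..<v'} \<subseteq> {0..1}" "affine_with_slope \<pi> c' {u'<..<v'}"
      using slope_interval_shift[OF c(3,2)] .
    have lt: "u' / b < v' / b" using uv b by (simp add: field_simps)
    have im: "(*) b ` {u' / b<..<v' / b} = {u'<..<v'}"
      using b by (simp add: image_mult_greaterThanLessThan)
    have "x \<in> D" if "x \<in> {u' / b<..<v' / b}" for x
    proof -
      have "b * x \<in> {0..1}" using that im uv(2) by blast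
      moreover from this have "0 \<le> x" using b by (simp add: zero_le_mult_iff)
      moreover from this have "1 \<le> b \<Longrightarrow> x \<le> b * x" using mult_right_mono[of 1 b x] by simp
      ultimately show ?thesis using D by auto
    qed
    then have "{u' / b<..<v' / b} \<subseteq> D" by blast
    then show "c \<in> slopes_on D (gj_to_dff b \<pi> l)"
      unfolding eq c(1) mem_Collect_eq aff using lt uv(3)
      by (intro exI[of _ "u' / b"] exI[of _ "v' / b"] conjI) (simp_all only: im)
  qed
qed

lemma has_slope_count_gj_to_dff:
  assumes D: "D = UNIV \<or> D = {0..1} \<and> 1 \<le> b"
    and pl: "piecewise_linear_on UNIV \<pi>" and l: "0 < l" "l < b"
  shows "has_slope_count UNIV \<pi> k \<longleftrightarrow> has_slope_count D (gj_to_dff b \<pi> l) k"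
proof -
  \<comment> \<open>The slope map has leading coefficient \<open>- b * l / (b - l)\<close>, which is
    nonzero, so it preserves the number of slopes.\<close>
  have "inj_on (\<lambda>c. b * (1 - l * c) / (b - l)) A" for A
    using l by (auto intro!: inj_onI)
  then show ?thesis
    unfolding has_slope_count_def slopes_on_gj_to_dff[OF assms]
    using pl piecewise_linear_gj_to_dff[OF pl l] by (simp add: card_image finite_image_iff)
qed

section \<open>Maximality\<close>

text \<open>The condition on \<open>e\<close> isolates what is required of \<open>l\<close> near
  \<open>0\<close>, so that the lemma covers both small \<open>l\<close> and the specific value
  \<open>1 / s\<close>.\<close>

lemma maximal_gj_to_dff:
  assumes D: "D = UNIV \<or> D = {0..1}" and l: "0 < l" "l < b"
    and e: "0 < e" "\<And>x. 0 < x \<Longrightarrow> x < e \<Longrightarrow> l * \<pi> x \<le> x"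
  shows "maximal_dff D (gj_to_dff b \<pi> l)"
proof -
  let ?\<phi> = "gj_to_dff b \<pi> l"
  have superadd: "?\<phi> x + ?\<phi> y \<le> ?\<phi> (x + y)" for x y
  proof -
    have "l * \<pi> (b * (x + y)) \<le> l * (\<pi> (b * x) + \<pi> (b * y))"
      unfolding distrib_left[of b] using subadd l by (intro mult_left_mono) auto
    then show ?thesis
      using l unfolding gj_to_dff_def add_divide_distrib[symmetric]
      by (intro divide_right_mono) (simp_all add: algebra_simps)
  qed
  have zero': "?\<phi> 0 = 0" by (simp add: gj_to_dff_def)
  have sym: "?\<phi> x + ?\<phi> (1 - x) = 1" for x
  proof -
    have "l * (\<pi> (b * x) + \<pi> (b - b * x)) = l" using symmetric[of "b * x"] by simp
    then have "b * x - l * \<pi> (b * x) + (b * (1 - x) - l * \<pi> (b * (1 - x))) = b - l"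
      by (simp add: algebra_simps)
    then show ?thesis using l unfolding gj_to_dff_def add_divide_distrib[symmetric] by simp
  qed
  have one: "?\<phi> 1 = 1" using sym[of 0] zero' by simp
  have multiple: "real n * ?\<phi> x \<le> ?\<phi> (real n * x)" for n x
  proof (induction n)
    case (Suc n)
    then show ?case using superadd[of x "real n * x"] by (simp add: algebra_simps)
  qed (simp add: zero')
  have nonneg': "0 \<le> ?\<phi> x" if "0 \<le> x" for x
  proof (cases "x = 0")
    case False
    then have x: "0 < x" using that by simp
    \<comment> \<open>Cutting \<open>x\<close> into \<open>n\<close> equal parts brings
      \<open>b * (x / n)\<close> below \<open>e\<close>; superadditivity carries nonnegativity back
      to \<open>x\<close>.\<close>
    obtain n where n: "b * x / e < real n" using reals_Archimedean2 by blast
    moreover have "0 < b * x / e" using x l e by simp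
    ultimately have n0: "0 < real n" by linarith
    have "0 < b * (x / n)" "b * (x / n) < e" using x n n0 l e(1) by (auto simp: field_simps)
    then have "0 \<le> ?\<phi> (x / n)" using e(2)[of "b * (x / n)"] l by (simp add: gj_to_dff_def)
    then have "0 \<le> real n * ?\<phi> (x / n)" using n0 by simp
    also have "\<dots> \<le> ?\<phi> x" using multiple[of n "x / n"] n0 by simp
    finally show ?thesis .
  qed (simp add: zero')
  have le1: "?\<phi> x \<le> 1" if "x \<le> 1" for x
    using superadd[of x "1 - x"] nonneg'[of "1 - x"] one that by simp
  have list: "sum_list (map ?\<phi> xs) \<le> ?\<phi> (sum_list xs)" for xs
  proof (induction xs)
    case (Cons x xs)
    then show ?case using superadd[of x "sum_list xs"] by simp
  qed (simp add: zero')
  have "dff D ?\<phi>"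
  proof (rule dffI)
    show "sum_list (map ?\<phi> xs) \<le> 1" if "sum_list xs \<le> 1" for xs
      using list[of xs] le1[OF that] by linarith
  qed (use D nonneg' le1 in auto)
  \<comment> \<open>A dominating \<open>\<psi>\<close> that is larger at \<open>x\<close> gives the
    pair \<open>x\<close>, \<open>1 - x\<close> a total above
    \<open>?\<phi> x + ?\<phi> (1 - x) = 1\<close>.\<close>
  moreover have False
    if \<psi>: "dff D \<psi>" "\<exists>x\<in>D. \<psi> x \<noteq> ?\<phi> x" "\<forall>x\<in>D. ?\<phi> x \<le> \<psi> x" for \<psi>
  proof -
    obtain x where x: "x \<in> D" "?\<phi> x < \<psi> x" using \<psi>(2,3) by force
    have x': "1 - x \<in> D" using D x by auto
    then have "sum_list (map \<psi> [x, 1 - x]) \<le> 1"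
      using x by (intro dff_sum_list_le[OF \<psi>(1)]) auto
    then show False using x \<psi>(3) x' sym[of x] by fastforce
  qed
  ultimately show ?thesis unfolding maximal_dff_def by blast
qed

end

section \<open>Extremality in the two-slope case\<close>

text \<open>Two nonnegative weighted gaps add up to zero, so the first one vanishes. This transfers
  equality from a convex combination to its first component.\<close>

lemma convex_combination_eqD:
  fixes t :: real
  assumes "t * a + (1 - t) * c = t * a' + (1 - t) * c'" "a \<le> a'" "c \<le> c'" "0 < t" "t < 1"
  shows "a = a'"
proof -
  have "t * (a' - a) + (1 - t) * (c' - c) = 0" using assms(1) by (simp add: algebra_simps)
  moreover have "0 \<le> t * (a' - a)" "0 \<le> (1 - t) * (c' - c)" using assms by auto
  ultimately have "t * (a' - a) = 0" by linarith
  then show ?thesis using assms by simp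
qed

text \<open>Cauchy's equation on an interval: nonnegativity makes \<open>a\<close> monotone, and
  comparison with the grid of step \<open>e / n\<close> bounds the error by \<open>a e / n\<close>
  for every positive \<open>n\<close>.\<close>

lemma additive_nonneg_linear:
  fixes a :: "real \<Rightarrow> real"
  assumes add: "\<And>y z. 0 \<le> y \<Longrightarrow> 0 \<le> z \<Longrightarrow> y + z \<le> e \<Longrightarrow> a (y + z) = a y + a z"
    and nonneg: "\<And>y. 0 \<le> y \<Longrightarrow> y \<le> e \<Longrightarrow> 0 \<le> a y"
    and y: "0 \<le> y" "y \<le> e" and e: "0 < e"
  shows "a y = a e / e * y"
proof (cases "y = e")
  case False
  have mono: "a u \<le> a v" if "0 \<le> u" "u \<le> v" "v \<le> e" for u v
    using add[of u "v - u"] nonneg[of "v - u"] that by simp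
  have mult: "a (real k * h) = real k * a h" if "0 \<le> h" "real k * h \<le> e" for k h
    using that(2)
  proof (induction k)
    case 0
    show ?case using add[of 0 0] e by simp
  next
    case (Suc k)
    then have le: "h + real k * h \<le> e" by (simp add: algebra_simps)
    then show ?case using add[of h "real k * h"] Suc that(1) by (simp add: algebra_simps)
  qed
  have "\<bar>a y - a e / e * y\<bar> = 0"
  proof (rule real_archimedian_rdiv_eq_0)
    show "real n * \<bar>a y - a e / e * y\<bar> \<le> a e" if n: "0 < n" for n
    proof -
      define h where "h = e / real n"
      have h: "0 < h" "real n * h = e" using n e by (auto simp: h_def)
      have ah: "a e = real n * a h" using mult[of h n] h by simp
      have ah0: "0 \<le> a h" using nonneg e ah n by (smt (verit) mult_less_0_iff of_nat_0_less_iff)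
      define k where "k = nat \<lfloor>y / h\<rfloor>"
      have "real k \<le> y / h" "y / h < real k + 1" using y h unfolding k_def by simp_all
      then have k: "real k * h \<le> y" "y < real (Suc k) * h" using h by (auto simp: field_simps)
      \<comment> \<open>Since \<open>y < e\<close>, the upper grid point \<open>Suc k * h\<close>
        stays in \<open>{0..e}\<close>, where additivity is available.\<close>
      have "real k * h < real n * h" using k y False h by linarith
      then have "Suc k \<le> n"
        using h(1) by (simp only: mult_less_cancel_right_pos of_nat_less_iff Suc_le_eq)
      then have "real (Suc k) * h \<le> real n * h" using h by (intro mult_right_mono) auto
      then have Suc: "real (Suc k) * h \<le> e" using h by simp
      have lo: "real k * a h \<le> a y" using mono[of "real k * h" y] mult[of h k] h k y by simp
      have hi: "a y \<le> real (Suc k) * a h"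
        using mono[of y "real (Suc k) * h"] mult[of h "Suc k"] Suc h k y by simp
      have eq: "a e / e * y = a h * (y / h)"
        using ah h n by (simp add: h_def field_simps)
      have "a h * real k \<le> a h * (y / h)" "a h * (y / h) \<le> a h * real (Suc k)"
        using k h ah0 by (intro mult_left_mono; simp add: field_simps)+
      then have "\<bar>a y - a e / e * y\<bar> \<le> a h"
        using lo hi unfolding eq by (simp add: abs_le_iff algebra_simps)
      then have "real n * \<bar>a y - a e / e * y\<bar> \<le> real n * a h" by (intro mult_left_mono) auto
      then show ?thesis using ah by simp
    qed
  qed simp
  then show ?thesis by simp
qed (use e in simp)

context subadditive_periodic_symmetric
begin

text \<open>By symmetry the reflection \<open>b - y\<close> turns the piece to the right of
  \<open>b - x\<close> into one to the left of \<open>x\<close> with the same slope.\<close>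

lemma left_affine_piece:
  assumes pl: "piecewise_linear_on UNIV \<pi>" and cont: "continuous_on UNIV \<pi>"
  shows "\<exists>r>0. \<exists>c\<in>slopes_on UNIV \<pi>. \<forall>y. x - r < y \<and> y \<le> x \<longrightarrow> \<pi> y = \<pi> x + c * (y - x)"
proof -
  have "continuous (at_right (b - x)) \<pi>"
    using cont by (simp add: continuous_on_eq_continuous_at continuous_at_imp_continuous_at_within)
  from right_affine_piece[OF pl this] obtain r c where rc: "0 < r" "c \<in> slopes_on UNIV \<pi>"
    and eq: "\<And>y. b - x \<le> y \<Longrightarrow> y < b - x + r \<Longrightarrow> \<pi> y = \<pi> (b - x) + c * (y - (b - x))"
    by blast
  have "\<pi> y = \<pi> x + c * (y - x)" if "x - r < y" "y \<le> x" for y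
    using eq[of "b - y"] symmetric[of x] symmetric[of y] that by (simp add: algebra_simps)
  with rc show ?thesis by blast
qed

text \<open>The heart of the two-slope argument, in the variable \<open>X = b x\<close>. Where \<open>\<phi>\<close> is constant, so
  are the nondecreasing \<open>\<phi>1\<close> and \<open>\<phi>2\<close>. Where \<open>\<pi>\<close> has slope \<open>s'\<close>, the slope of \<open>\<phi>1\<close> is
  its slope to the left of \<open>1\<close>, because \<open>\<phi>\<close> is additive at \<open>(Y, 1 - (Y - X))\<close> and at \<open>(X, 1)\<close>.
  The point \<open>1\<close> stands in for \<open>0\<close>, whose left neighbourhood is missing in the classical case.\<close>

lemma two_slope_component_eq:
  assumes D: "D = UNIV \<or> D = {0..1} \<and> 2 \<le> b"
    and l: "0 < l" "l < b"
    and s: "l * s = 1" and s': "s' \<le> 0"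
    and right: "\<And>x. \<exists>r>0. \<exists>c\<in>{s, s'}. \<forall>y. x \<le> y \<and> y < x + r \<longrightarrow> \<pi> y = \<pi> x + c * (y - x)"
    and left: "\<And>x. \<exists>r>0. \<exists>c\<in>{s, s'}. \<forall>y. x - r < y \<and> y \<le> x \<longrightarrow> \<pi> y = \<pi> x + c * (y - x)"
    and e: "0 < e" "e \<le> 1" and neg: "\<And>y. 0 \<le> y \<Longrightarrow> y \<le> e \<Longrightarrow> \<pi> (- y) = - s' * y"
    and max: "maximal_dff D \<phi>1" "maximal_dff D \<phi>2"
    and t: "0 < t" "t < 1"
    and conv: "\<And>x. x \<in> D \<Longrightarrow> gj_to_dff b \<pi> l x = t * \<phi>1 x + (1 - t) * \<phi>2 x"
    and x: "x \<in> D"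
  shows "\<phi>1 x = gj_to_dff b \<pi> l x"
proof -
  have b: "0 < b" using l by simp
  have D': "D = UNIV \<or> D = {0..1}" using D by auto
  \<comment> \<open>\<open>E\<close> is the domain in the variable \<open>X = b * x\<close>: the
    whole line or \<open>{0..b}\<close>.\<close>
  define E where "E = {X. X / b \<in> D}"
  have E: "E = UNIV \<or> E = {0..b} \<and> 2 \<le> b" using D b by (auto simp: E_def field_simps)
  have convE: "convex E" using E by auto
  define F1 F2 \<Phi> where "F1 X = \<phi>1 (X / b)" and "F2 X = \<phi>2 (X / b)"
    and "\<Phi> X = (X - l * \<pi> X) / (b - l)" for X
  have conv': "\<Phi> X = t * F1 X + (1 - t) * F2 X" if "X \<in> E" for X
    using conv[of "X / b"] that b by (simp add: E_def F1_def F2_def \<Phi>_def gj_to_dff_def)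
  note convD = convex_combination_eqD[OF _ _ _ t]
  have super: "F1 X + F1 Y \<le> F1 (X + Y)" "F2 X + F2 Y \<le> F2 (X + Y)"
    if "X \<in> E" "Y \<in> E" "X + Y \<in> E" for X Y
    using maximal_dff_sum_list_le[OF D' max(1), of "[X / b, Y / b]" "(X + Y) / b"]
      maximal_dff_sum_list_le[OF D' max(2), of "[X / b, Y / b]" "(X + Y) / b"] that
    by (auto simp: E_def F1_def F2_def add_divide_distrib)
  \<comment> \<open>Both parts are superadditive and their combination is additive wherever
    \<open>\<pi>\<close> is, so \<open>F1\<close> has no slack there.\<close>
  have add: "F1 (X + Y) = F1 X + F1 Y"
    if XY: "X \<in> E" "Y \<in> E" "X + Y \<in> E" and \<pi>: "\<pi> (X + Y) = \<pi> X + \<pi> Y" for X Y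
  proof (rule sym, rule convD)
    have "\<Phi> (X + Y) = \<Phi> X + \<Phi> Y"
      unfolding \<Phi>_def \<pi> add_divide_distrib[symmetric] by (simp add: algebra_simps)
    then show "t * (F1 X + F1 Y) + (1 - t) * (F2 X + F2 Y) =
        t * F1 (X + Y) + (1 - t) * F2 (X + Y)"
      unfolding conv'[OF XY(1)] conv'[OF XY(2)] conv'[OF XY(3)] by (simp add: algebra_simps)
  qed (use super XY in auto)
  have mono: "F1 X \<le> F1 Y" "F2 X \<le> F2 Y" if "X \<in> E" "Y \<in> E" "X \<le> Y" for X Y
    using maximal_dff_sum_list_le[OF D' max(1), of "[X / b]" "Y / b"]
      maximal_dff_sum_list_le[OF D' max(2), of "[X / b]" "Y / b"] that b
    by (auto simp: E_def F1_def F2_def divide_right_mono)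
  have inE: "0 \<in> E" "b \<in> E" "1 \<in> E" "2 \<in> E" using E b by auto
  have F1_0: "F1 0 = 0" using add[of 0 0] inE by simp
  have \<pi>b: "\<pi> b = 1" using symmetric[of 0] by simp
  \<comment> \<open>Feasibility of a one-member family bounds both parts by \<open>1\<close> at this
    point, and \<open>\<Phi>\<close> attains the bound.\<close>
  have F1_b: "F1 b = 1"
  proof (rule convD)
    have "\<Phi> b = 1" using l \<pi>b by (simp add: \<Phi>_def)
    then show "t * F1 b + (1 - t) * F2 b = t * 1 + (1 - t) * 1"
      using conv'[OF inE(2)] by simp
    have "1 \<in> D" using D by auto
    then show "F1 b \<le> 1" "F2 b \<le> 1"
      using max dff_sum_list_le[of D _ "[1]"] b by (auto simp: F1_def F2_def maximal_dff_def)
  qed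
  have refl: "b - X \<in> E" "F1 (b - X) = 1 - F1 X" if "X \<in> E" for X
  proof -
    show b': "b - X \<in> E" using E that by auto
    show "F1 (b - X) = 1 - F1 X"
      using add[of X "b - X"] b' that inE symmetric[of X] \<pi>b F1_b by simp
  qed
  have shift: "F1 (X + 1) = F1 X + F1 1" if "X \<in> E" "X + 1 \<in> E" for X
    using add[of X 1] that inE periodic[of 1 X] periodic[of 1 0] by simp
  have drop': "F1 Y - F1 X = F1 1 - F1 (1 - (Y - X))"
    if XY: "X \<in> E" "X + 1 \<in> E" "Y \<in> E" "X \<le> Y" "Y - X \<le> e"
      and \<pi>: "\<pi> Y - \<pi> X = s' * (Y - X)" for X Y
  proof -
    have "\<pi> (1 - (Y - X)) = \<pi> (- (Y - X))" using periodic[of 1 "- (Y - X)"]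
      by (simp add: algebra_simps)
    then have "\<pi> X = \<pi> Y + \<pi> (1 - (Y - X))" using neg[of "Y - X"] \<pi> XY by simp
    moreover have "\<pi> (Y + (1 - (Y - X))) = \<pi> X"
      using periodic[of 1 X] by (simp add: add.commute)
    moreover have "1 - (Y - X) \<in> E" using E e XY by auto
    moreover have "Y + (1 - (Y - X)) \<in> E" using XY(2) by (simp add: add.commute)
    ultimately have "F1 (Y + (1 - (Y - X))) = F1 Y + F1 (1 - (Y - X))"
      using XY(3) by (intro add) simp_all
    moreover have "Y + (1 - (Y - X)) = X + 1" by simp
    ultimately show ?thesis using shift[OF XY(1,2)] by simp
  qed
  have drop: "F1 Y - F1 X = F1 1 - F1 (1 - (Y - X))"
    if XY: "X \<in> E" "Y \<in> E" "X \<le> Y" "Y - X \<le> e"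
      and \<pi>: "\<pi> Y - \<pi> X = s' * (Y - X)" for X Y
  proof (cases "X + 1 \<in> E")
    case True
    then show ?thesis using drop' XY \<pi> by simp
  next
    \<comment> \<open>Here \<open>E\<close> is \<open>{0..b}\<close> and
      \<open>X > b - 1 \<ge> 1\<close>. Reflection moves the interval to
      \<open>{b - Y..b - X}\<close>, whose left end has room for a shift by
      \<open>1\<close>.\<close>
    case False
    have "b - Y + 1 \<in> E" using False E XY by auto
    moreover have "\<pi> (b - X) - \<pi> (b - Y) = s' * ((b - X) - (b - Y))"
      using symmetric[of X] symmetric[of Y] \<pi> by simp
    ultimately have "F1 (b - X) - F1 (b - Y) = F1 1 - F1 (1 - ((b - X) - (b - Y)))"
      using XY refl(1) by (intro drop') auto
    then show ?thesis using refl(2) XY by simp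
  qed
  \<comment> \<open>\<open>a y\<close> is the increment of \<open>F1\<close> over
    \<open>{1 - y..1}\<close>; applying \<open>drop\<close> to the adjacent interval of length
    \<open>z\<close> shows that \<open>a\<close> is additive.\<close>
  define a where "a y = F1 1 - F1 (1 - y)" for y
  have inE': "1 - y \<in> E" if "0 \<le> y" "y \<le> e" for y using E e that by auto
  have "a (y + z) = a y + a z" if yz: "0 \<le> y" "0 \<le> z" "y + z \<le> e" for y z
  proof -
    have "\<pi> (1 - w) = - s' * w" if "0 \<le> w" "w \<le> e" for w
      using neg[OF that] periodic[of 1 "- w"] by simp
    then have "\<pi> (1 - y) - \<pi> (1 - (y + z)) = s' * ((1 - y) - (1 - (y + z)))"
      using yz by (simp add: algebra_simps)
    then have "F1 (1 - y) - F1 (1 - (y + z)) = F1 1 - F1 (1 - ((1 - y) - (1 - (y + z))))"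
      using yz inE' by (intro drop) auto
    then show ?thesis by (simp add: a_def)
  qed
  moreover have "0 \<le> a y" if "0 \<le> y" "y \<le> e" for y
    using mono(1)[of "1 - y" 1] inE' inE that by (simp add: a_def)
  ultimately have lin: "a y = a e / e * y" if "0 \<le> y" "y \<le> e" for y
    using additive_nonneg_linear e(1) that by blast
  \<comment> \<open>These are the slopes of \<open>\<Phi>\<close> and of \<open>F1\<close> where
    \<open>\<pi>\<close> has slope \<open>s'\<close>; \<open>q / p\<close> is the only possible
    factor between the two functions.\<close>
  define p q where "p = (1 - l * s') / (b - l)" and "q = a e / e"
  have p: "0 < p" using l s' mult_nonneg_nonpos[of l s'] by (auto simp: p_def intro!: divide_pos_pos)
  define G where "G X = F1 X - q / p * \<Phi> X" for X
  have G_eq: "G X = G Y"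
    if XY: "X \<in> E" "Y \<in> E" "X \<le> Y" "Y - X \<le> e" and c: "c \<in> {s, s'}"
      and \<pi>: "\<pi> Y - \<pi> X = c * (Y - X)" for X Y c
  proof -
    have "\<Phi> Y - \<Phi> X = (Y - X - l * (\<pi> Y - \<pi> X)) / (b - l)"
      unfolding \<Phi>_def diff_divide_distrib[symmetric] by (simp add: algebra_simps)
    then have \<Phi>: "\<Phi> Y - \<Phi> X = (1 - l * c) / (b - l) * (Y - X)"
      unfolding \<pi> mult.assoc[symmetric] left_diff_distrib[of 1, symmetric]
      by (simp add: left_diff_distrib)
    show ?thesis
    proof (cases "c = s'")
      case True
      then have "F1 Y - F1 X = q * (Y - X)"
        using drop[OF XY] \<pi> lin[of "Y - X"] XY by (simp add: a_def q_def)
      moreover have "\<Phi> Y - \<Phi> X = p * (Y - X)" using True \<Phi> by (simp only: p_def)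
      then have "q / p * (\<Phi> Y - \<Phi> X) = q * (Y - X)" using p by simp
      ultimately show ?thesis unfolding G_def right_diff_distrib by linarith
    next
      case False
      \<comment> \<open>Here \<open>c = s\<close>, and \<open>l * s = 1\<close> makes the increment
        of \<open>\<Phi>\<close> vanish; two nondecreasing parts of a flat combination cannot
        rise.\<close>
      then have \<Phi>_eq: "\<Phi> X = \<Phi> Y" using c s \<Phi> by simp
      have "F1 X = F1 Y"
      proof (rule convD)
        show "t * F1 X + (1 - t) * F2 X = t * F1 Y + (1 - t) * F2 Y"
          using \<Phi>_eq unfolding conv'[OF XY(1)] conv'[OF XY(2)] .
      qed (use mono XY in auto)
      then show ?thesis using \<Phi>_eq by (simp add: G_def)
    qed
  qed
  \<comment> \<open>\<open>G\<close> is constant near each point of \<open>E\<close>, on both sides;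
    a zero derivative on a convex set then replaces a walk along all pieces.\<close>
  have "(G has_field_derivative 0) (at X within E)" if X: "X \<in> E" for X
  proof -
    obtain r1 c1 where r1: "0 < r1" "c1 \<in> {s, s'}"
      and eq1: "\<And>y. X \<le> y \<Longrightarrow> y < X + r1 \<Longrightarrow> \<pi> y = \<pi> X + c1 * (y - X)"
      using right[of X] by blast
    obtain r2 c2 where r2: "0 < r2" "c2 \<in> {s, s'}"
      and eq2: "\<And>y. X - r2 < y \<Longrightarrow> y \<le> X \<Longrightarrow> \<pi> y = \<pi> X + c2 * (y - X)"
      using left[of X] by blast
    define r where "r = min e (min r1 r2)"
    have r: "0 < r" "r \<le> e" "r \<le> r1" "r \<le> r2" using e r1 r2 by (auto simp: r_def)
    have const: "G Y = G X" if Y: "Y \<in> E" "dist Y X < r" for Y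
    proof (cases "X \<le> Y")
      case True
      then show ?thesis
        using G_eq[OF X Y(1) True _ r1(2)] eq1[of Y] Y r by (simp add: dist_real_def)
    next
      case False
      then have "Y \<le> X" "X - Y \<le> e" "\<pi> X - \<pi> Y = c2 * (X - Y)"
        using eq2[of Y] Y r by (auto simp: dist_real_def algebra_simps)
      then show ?thesis using G_eq[OF Y(1) X _ _ r2(2)] by simp
    qed
    show ?thesis
      by (rule has_field_derivative_transform_within[where f = "\<lambda>_. G X", OF _ r(1) X])
        (use const in auto)
  qed
  then obtain C where C: "\<And>X. X \<in> E \<Longrightarrow> G X = C"
    using has_field_derivative_zero_constant[OF convE] by blast
  \<comment> \<open>The value at \<open>0\<close> fixes the constant as \<open>0\<close>; the value
    \<open>1\<close> at \<open>b\<close> then forces \<open>q / p = 1\<close>.\<close>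
  have G0: "G X = 0" if "X \<in> E" for X
    using C[OF inE(1)] C[OF that] F1_0 by (simp add: G_def \<Phi>_def)
  have "\<Phi> b = 1" using l \<pi>b by (simp add: \<Phi>_def)
  then have "q / p = 1" using G0[OF inE(2)] F1_b by (simp add: G_def)
  then have "F1 (b * x) = \<Phi> (b * x)" using G0[of "b * x"] x b by (simp add: G_def E_def)
  then show ?thesis using b by (simp add: F1_def \<Phi>_def gj_to_dff_def)
qed

text \<open>Nonnegativity and \<open>\<pi> 0 = 0\<close> make the slope left of \<open>0\<close>
  nonpositive, hence equal to \<open>s'\<close>, and the slope right of \<open>0\<close>
  nonnegative; subadditivity excludes the value \<open>0\<close> on the right.\<close>

lemma two_slope_obtain:
  assumes pl: "piecewise_linear_on UNIV \<pi>" and cont: "continuous_on UNIV \<pi>"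
    and two: "has_slope_count UNIV \<pi> 2" and s: "s \<in> slopes_on UNIV \<pi>" "0 < s"
  obtains s' e where "slopes_on UNIV \<pi> = {s, s'}" "s' \<le> 0" "0 < e" "e \<le> 1"
    "\<And>y. 0 \<le> y \<Longrightarrow> y \<le> e \<Longrightarrow> \<pi> (- y) = - s' * y"
    "\<And>y. 0 \<le> y \<Longrightarrow> y \<le> e \<Longrightarrow> \<pi> y = s * y"
proof -
  have "card (slopes_on UNIV \<pi>) = 2" using two by (simp add: has_slope_count_def)
  then obtain s' where S: "slopes_on UNIV \<pi> = {s, s'}"
    using s(1) by (auto simp: card_2_iff doubleton_eq_iff)
  obtain r1 c1 where r1: "0 < r1" "c1 \<in> {s, s'}"
    and eq1: "\<And>y. - r1 < y \<Longrightarrow> y \<le> 0 \<Longrightarrow> \<pi> y = c1 * y"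
    using left_affine_piece[OF pl cont, of 0] unfolding S by force
  have "continuous (at_right 0) \<pi>"
    using cont by (simp add: continuous_on_eq_continuous_at continuous_at_imp_continuous_at_within)
  from right_affine_piece[OF pl this] obtain r2 c2 where r2: "0 < r2" "c2 \<in> {s, s'}"
    and eq2: "\<And>y. 0 \<le> y \<Longrightarrow> y < r2 \<Longrightarrow> \<pi> y = c2 * y"
    unfolding S by force
  obtain y1 where y1: "0 < y1" "y1 < r1" using dense[OF r1(1)] by blast
  then have "c1 * y1 \<le> 0" using eq1[of "- y1"] nonneg[of "- y1"] by simp
  then have "c1 \<le> 0" using y1(1) by (simp add: mult_le_0_iff)
  then have c1: "c1 = s'" "s' \<le> 0" using r1 s by auto
  obtain y2 where y2: "0 < y2" "y2 < r2" using dense[OF r2(1)] by blast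
  then have "0 \<le> c2 * y2" using eq2[of y2] nonneg[of y2] by simp
  then have c2_ge: "0 \<le> c2" using y2(1) by (simp add: zero_le_mult_iff)
  have c2: "c2 = s"
  proof (rule ccontr)
    assume "c2 \<noteq> s"
    then have "c2 = 0" using r2 c1 c2_ge by auto
    obtain u v d where uv: "u < v" "\<And>x. u < x \<Longrightarrow> x < v \<Longrightarrow> \<pi> x = s * x + d"
      using s(1) unfolding slopes_on_eq[OF pl] by (auto simp: affine_with_slope_def)
    \<comment> \<open>Both \<open>x\<close> and \<open>x + y\<close> lie on a piece of slope
      \<open>s\<close>, while \<open>y\<close> lies in the supposedly flat piece right of
      \<open>0\<close>; subadditivity would then forbid the rise.\<close>
    define x y where "x = (u + v) / 2" and "y = min r2 (v - u) / 4"
    have xy: "u < x" "x < v" "0 < y" "y < r2" "x + y < v"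
      using uv(1) r2(1) unfolding x_def y_def by (auto simp: min_def field_simps)
    have "\<pi> (x + y) \<le> \<pi> x" using subadd[of x y] eq2[of y] xy \<open>c2 = 0\<close> by simp
    then have "s * y \<le> 0" using uv(2)[of x] uv(2)[of "x + y"] xy by (simp add: algebra_simps)
    then show False using s(2) xy(3) by (simp add: mult_le_0_iff)
  qed
  define e where "e = min 1 (min r1 r2 / 2)"
  have e: "0 < e" "e \<le> 1" "e < r1" "e < r2" using r1 r2 by (auto simp: e_def min_def)
  show ?thesis
    by (rule that[OF S c1(2) e(1,2)]) (use eq1 eq2 c1 c2 e in auto)
qed

text \<open>The condition \<open>1 < s * b\<close> says that \<open>1 / s < b\<close>. Right of
  \<open>0\<close> the slope of \<open>\<pi>\<close> is \<open>s\<close>, so the bound required for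
  maximality holds with equality.\<close>

lemma extreme_gj_to_dff:
  assumes D: "D = UNIV \<or> D = {0..1} \<and> 2 \<le> b"
    and pl: "piecewise_linear_on UNIV \<pi>" and cont: "continuous_on UNIV \<pi>"
    and two: "has_slope_count UNIV \<pi> 2" and s: "s \<in> slopes_on UNIV \<pi>" "0 < s" "1 < s * b"
  shows "extreme_dff D (gj_to_dff b \<pi> (1 / s))"
proof -
  define l where "l = 1 / s"
  have l: "0 < l" "l < b" "l * s = 1" using s by (auto simp: l_def field_simps)
  obtain s' e where S: "slopes_on UNIV \<pi> = {s, s'}" "s' \<le> 0" and e: "0 < e" "e \<le> 1"
    and neg: "\<And>y. 0 \<le> y \<Longrightarrow> y \<le> e \<Longrightarrow> \<pi> (- y) = - s' * y"
    and pos: "\<And>y. 0 \<le> y \<Longrightarrow> y \<le> e \<Longrightarrow> \<pi> y = s * y"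
    using two_slope_obtain[OF pl cont two s(1,2)] by blast
  have max: "maximal_dff D (gj_to_dff b \<pi> l)"
  proof (rule maximal_gj_to_dff[OF _ l(1,2) e(1)])
    show "l * \<pi> x \<le> x" if "0 < x" "x < e" for x
      using pos[of x] that l(3) by (simp add: mult.assoc[symmetric])
  qed (use D in auto)
  have right: "\<exists>r>0. \<exists>c\<in>{s, s'}. \<forall>y. x \<le> y \<and> y < x + r \<longrightarrow> \<pi> y = \<pi> x + c * (y - x)" for x
  proof -
    have "continuous (at_right x) \<pi>"
      using cont
      by (simp add: continuous_on_eq_continuous_at continuous_at_imp_continuous_at_within)
    from right_affine_piece[OF pl this] show ?thesis unfolding S .
  qed
  have left: "\<exists>r>0. \<exists>c\<in>{s, s'}. \<forall>y. x - r < y \<and> y \<le> x \<longrightarrow> \<pi> y = \<pi> x + c * (y - x)" for x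
    using left_affine_piece[OF pl cont, of x] unfolding S .
  have False
    if max12: "maximal_dff D \<phi>1" "maximal_dff D \<phi>2"
      and ne: "\<exists>x\<in>D. \<phi>1 x \<noteq> gj_to_dff b \<pi> l x" "\<exists>x\<in>D. \<phi>2 x \<noteq> gj_to_dff b \<pi> l x"
      and t: "0 \<le> t" "t \<le> 1"
      and conv: "\<forall>x\<in>D. gj_to_dff b \<pi> l x = t * \<phi>1 x + (1 - t) * \<phi>2 x" for \<phi>1 \<phi>2 t
  proof -
    \<comment> \<open>With \<open>t\<close> equal to \<open>0\<close> or \<open>1\<close>, one of
      the two parts would coincide with the given function.\<close>
    have "t \<noteq> 0" "t \<noteq> 1" using ne conv by auto
    then have t': "0 < t" "t < 1" using t by auto
    have "\<phi>1 x = gj_to_dff b \<pi> l x" if "x \<in> D" for x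
      by (rule two_slope_component_eq[OF D l S(2) right left e neg max12 t' _ that])
        (use conv in auto)
    then show False using ne by blast
  qed
  then have "extreme_dff D (gj_to_dff b \<pi> l)" using max unfolding extreme_dff_def by blast
  then show ?thesis by (simp add: l_def)
qed

end

theorem theorem2p1:
  fixes b :: real and \<pi> :: "real \<Rightarrow> real"
  assumes "b > 0" and "b \<notin> \<int>"
    and "minimal_gj b \<pi>"
    and "piecewise_linear_on UNIV \<pi>"
    and "continuous (at_right 0) \<pi>"
  shows "(\<exists>\<delta>>0. \<forall>l. 0 < l \<and> l < \<delta> \<longrightarrow>
            maximal_dff UNIV (gj_to_dff b \<pi> l) \<and>
            maximal_dff {0..1} (gj_to_dff b \<pi> l) \<and>
            (\<forall>k. has_slope_count UNIV \<pi> k \<longleftrightarrow> has_slope_count UNIV (gj_to_dff b \<pi> l) k) \<and>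
            (b > 1 \<longrightarrow>
              (\<forall>k. has_slope_count UNIV \<pi> k \<longleftrightarrow> has_slope_count {0..1} (gj_to_dff b \<pi> l) k))) \<and>
         (\<forall>l s. continuous_on UNIV \<pi> \<and> has_slope_count UNIV \<pi> 2 \<and>
                s \<in> slopes_on UNIV \<pi> \<and> s > 0 \<and> s * b > 1 \<and> l = 1 / s \<longrightarrow>
            extreme_dff UNIV (gj_to_dff b \<pi> l) \<and>
            (b > 3 \<longrightarrow> extreme_dff {0..1} (gj_to_dff b \<pi> l)))"
proof
  interpret subadditive_periodic_symmetric b \<pi> using assms(3) by (rule minimal_gj_imp)
  obtain r c where r: "0 < r" and eq: "\<And>y. 0 \<le> y \<Longrightarrow> y < r \<Longrightarrow> \<pi> y = c * y"
    using right_affine_piece[OF assms(4,5)] by force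
  \<comment> \<open>Here \<open>c\<close> is the slope of \<open>\<pi>\<close> right of
    \<open>0\<close>. The first bound keeps \<open>b - l\<close> positive, the second gives
    \<open>l * c < 1\<close>; the added \<open>1\<close> covers \<open>c = 0\<close>.\<close>
  define \<delta> where "\<delta> = min b (1 / (\<bar>c\<bar> + 1))"
  have "0 < \<delta>" using assms(1) by (simp add: \<delta>_def)
  moreover have "maximal_dff D (gj_to_dff b \<pi> l)"
    if "D = UNIV \<or> D = {0..1}" "0 < l" "l < \<delta>" for D l
  proof (rule maximal_gj_to_dff[OF that(1,2) _ r])
    show "l < b" using that by (simp add: \<delta>_def)
    fix x assume x: "0 < x" "x < r"
    have "l * (\<bar>c\<bar> + 1) < 1" using that by (simp add: \<delta>_def field_simps)
    moreover have "l * c \<le> l * (\<bar>c\<bar> + 1)" using that by (intro mult_left_mono) auto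
    ultimately have "l * c * x \<le> 1 * x" using x by (intro mult_right_mono) auto
    then show "l * \<pi> x \<le> x" using eq[of x] x by simp
  qed
  moreover have "l < b" if "l < \<delta>" for l using that by (simp add: \<delta>_def)
  ultimately show "\<exists>\<delta>>0. \<forall>l. 0 < l \<and> l < \<delta> \<longrightarrow>
            maximal_dff UNIV (gj_to_dff b \<pi> l) \<and>
            maximal_dff {0..1} (gj_to_dff b \<pi> l) \<and>
            (\<forall>k. has_slope_count UNIV \<pi> k \<longleftrightarrow> has_slope_count UNIV (gj_to_dff b \<pi> l) k) \<and>
            (b > 1 \<longrightarrow>
              (\<forall>k. has_slope_count UNIV \<pi> k \<longleftrightarrow> has_slope_count {0..1} (gj_to_dff b \<pi> l) k))"
    using has_slope_count_gj_to_dff[OF _ assms(4)] by (intro exI[of _ \<delta>]) auto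
  show "\<forall>l s. continuous_on UNIV \<pi> \<and> has_slope_count UNIV \<pi> 2 \<and>
                s \<in> slopes_on UNIV \<pi> \<and> s > 0 \<and> s * b > 1 \<and> l = 1 / s \<longrightarrow>
            extreme_dff UNIV (gj_to_dff b \<pi> l) \<and>
            (b > 3 \<longrightarrow> extreme_dff {0..1} (gj_to_dff b \<pi> l))"
    using extreme_gj_to_dff[OF _ assms(4)] by auto
qed

end
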